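(* Let $G_1$ and $G_2$ be unicyclic graphs such that $G_1$ has a perfect matching and $2$ is an eigenvalue of $L(G_1)$, while $2$ is not an eigenvalue of $L(G_2)$. Let $u\in V(G_1)$ and $v\in V(G_2)$. Then $2$ is an eigenvalue of $L(G_1\odot_{uv}G_2)$ if and only if there exists an eigenvector $X$ of $L(G_1)$ corresponding to the eigenvalue $2$ with $x(u)=0$, where $x(u)$ denotes the entry of $X$ at the vertex $u$.
   Context: All graphs are finite, undirected, without loops or multiple edges. The Laplacian matrix of a graph $G$ is $L(G)=D(G)-A(G)$, where $D(G)$ is the diagonal matrix of vertex degrees and $A(G)$ is the adjacency matrix. A unicyclic graph is a connected graph whose number of edges equals its number of vertices. For graphs $G_1,G_2$ with disjoint vertex sets, $u\in V(G_1)$ and $v\in V(G_2)$, the one-edge connection $G_1\odot_{uv}G_2$ is the graph with vertex set $V(G_1)\cup V(G_2)$ and edge set $E(G_1)\cup E(G_2)\cup\{uv\}$. Eigenvectors are nonzero real vectors indexed by the vertices. *)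

theory Defs
  imports "HOL-Analysis.Analysis"
begin

(* A graph is given by its edge set; its vertices are all elements of the finite type 'a. *)

definition simple_graph :: "'a set set \<Rightarrow> bool" where
  "simple_graph E \<longleftrightarrow> (\<forall>e\<in>E. card e = 2)"

definition adjacent :: "'a set set \<Rightarrow> 'a \<Rightarrow> 'a \<Rightarrow> bool" where
  "adjacent E a b \<longleftrightarrow> {a, b} \<in> E"

definition connected_graph :: "'a set set \<Rightarrow> bool" where
  "connected_graph E \<longleftrightarrow> (\<forall>a b. (adjacent E)\<^sup>*\<^sup>* a b)"

definition unicyclic :: "'a::finite set set \<Rightarrow> bool" where
  "unicyclic E \<longleftrightarrow> simple_graph E \<and> connected_graph E \<and> card E = CARD('a)"

definition matching :: "'a set set \<Rightarrow> 'a set set \<Rightarrow> bool" where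
  "matching E M \<longleftrightarrow> M \<subseteq> E \<and> pairwise disjnt M"

definition perfect_matching :: "'a set set \<Rightarrow> 'a set set \<Rightarrow> bool" where
  "perfect_matching E M \<longleftrightarrow> matching E M \<and> \<Union>M = UNIV"

definition vertex_degree :: "'a::finite set set \<Rightarrow> 'a \<Rightarrow> nat" where
  "vertex_degree E a = card {e \<in> E. a \<in> e}"

definition degree_matrix :: "'a::finite set set \<Rightarrow> real^'a^'a" where
  "degree_matrix E = (\<chi> a b. if a = b then real (vertex_degree E a) else 0)"

definition adjacency_matrix :: "'a::finite set set \<Rightarrow> real^'a^'a" where
  "adjacency_matrix E = (\<chi> a b. if adjacent E a b then 1 else 0)"

definition laplacian :: "'a::finite set set \<Rightarrow> real^'a^'a" where
  "laplacian E = degree_matrix E - adjacency_matrix E"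

definition eigenvector :: "real^'n^'n \<Rightarrow> real \<Rightarrow> real^'n \<Rightarrow> bool" where
  "eigenvector A c x \<longleftrightarrow> x \<noteq> 0 \<and> A *v x = c *s x"

definition eigenvalue :: "real^'n^'n \<Rightarrow> real \<Rightarrow> bool" where
  "eigenvalue A c \<longleftrightarrow> (\<exists>x. eigenvector A c x)"

(* The sum type makes the two vertex sets disjoint. *)
definition one_edge_connection ::
    "'a set set \<Rightarrow> 'a \<Rightarrow> 'b set set \<Rightarrow> 'b \<Rightarrow> ('a + 'b) set set" where
  "one_edge_connection E1 u E2 v =
     (\<lambda>e. Inl ` e) ` E1 \<union> (\<lambda>e. Inr ` e) ` E2 \<union> {{Inl u, Inr v}}"

end

theory Submission
  imports Defs
begin

text \<open>
  For a vector \<open>(X, Y)\<close> on the connected graph, the eigenvalue equation reads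
  \<open>(L\<^sub>1 - 2) X = - c e\<^sub>u\<close> and \<open>(L\<^sub>2 - 2) Y = c e\<^sub>v\<close> with \<open>c = x(u) - y(v)\<close>.
  If \<open>c = 0\<close>, then \<open>Y = 0\<close> since 2 is not an eigenvalue of \<open>L\<^sub>2\<close>, so \<open>x(u) = 0\<close> and \<open>X\<close> is an
  eigenvector of \<open>L\<^sub>1\<close>. If \<open>c \<noteq> 0\<close>, then pairing the first equation with any eigenvector \<open>Z\<close> of the
  symmetric matrix \<open>L\<^sub>1\<close> for the eigenvalue 2 gives \<open>c z(u) = 0\<close>. Conversely, an eigenvector of
  \<open>L\<^sub>1\<close> vanishing at \<open>u\<close> extends by zero.
\<close>

lemma adjacent_commute: "adjacent E a b \<longleftrightarrow> adjacent E b a"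
  by (simp add: adjacent_def insert_commute)

lemma transpose_laplacian: "transpose (laplacian E) = laplacian E"
  by (simp add: vec_eq_iff transpose_def laplacian_def degree_matrix_def adjacency_matrix_def
      adjacent_commute)

text \<open>A real symmetric matrix is self-adjoint for the inner product.\<close>

lemma inner_laplacian_commute: "Z \<bullet> (laplacian E *v X) = (laplacian E *v Z) \<bullet> X"
  by (metis dot_lmul_matrix transpose_laplacian transpose_matrix_vector)

lemma laplacian_mult_vec_nth:
  "(laplacian E *v x) $ a =
    real (vertex_degree E a) * x $ a - (\<Sum>b\<in>UNIV. if adjacent E a b then x $ b else 0)"
proof -
  \<comment> \<open>The diagonal term is written with \<open>x $ a\<close> rather than
    \<open>x $ b\<close>, so that its sum over \<open>b\<close> collapses to a single
    constant.\<close>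
  have "(laplacian E *v x) $ a =
      (\<Sum>b\<in>UNIV. (if b = a then real (vertex_degree E a) * x $ a else 0)
        - (if adjacent E a b then x $ b else 0))"
    unfolding matrix_vector_mult_def laplacian_def degree_matrix_def adjacency_matrix_def
    by (auto intro!: sum.cong simp: left_diff_distrib)
  then show ?thesis
    by (simp add: sum_subtractf)
qed

lemma adjacent_one_edge_connection:
  "adjacent (one_edge_connection E1 u E2 v) (Inl a) (Inl b) \<longleftrightarrow> adjacent E1 a b"
  "adjacent (one_edge_connection E1 u E2 v) (Inr c) (Inr d) \<longleftrightarrow> adjacent E2 c d"
  "adjacent (one_edge_connection E1 u E2 v) (Inl a) (Inr d) \<longleftrightarrow> a = u \<and> d = v"
  "adjacent (one_edge_connection E1 u E2 v) (Inr d) (Inl a) \<longleftrightarrow> a = u \<and> d = v"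
proof -
  have l: "{Inl a, Inl b} = Inl ` e \<longleftrightarrow> e = {a, b}" for e :: "'a set" and a b
    using inj_image_eq_iff[of Inl "{a, b}" e] by auto
  have r: "{Inr c, Inr d} = Inr ` e \<longleftrightarrow> e = {c, d}" for e :: "'b set" and c d
    using inj_image_eq_iff[of Inr "{c, d}" e] by auto
  show "adjacent (one_edge_connection E1 u E2 v) (Inl a) (Inl b) \<longleftrightarrow> adjacent E1 a b"
    "adjacent (one_edge_connection E1 u E2 v) (Inr c) (Inr d) \<longleftrightarrow> adjacent E2 c d"
    by (auto simp: adjacent_def one_edge_connection_def image_iff l r doubleton_eq_iff)
  show "adjacent (one_edge_connection E1 u E2 v) (Inl a) (Inr d) \<longleftrightarrow> a = u \<and> d = v"
    "adjacent (one_edge_connection E1 u E2 v) (Inr d) (Inl a) \<longleftrightarrow> a = u \<and> d = v"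
    by (auto simp: adjacent_def one_edge_connection_def doubleton_eq_iff)
qed

text \<open>The edges at a vertex are the injective images of its old edges, joined by the bridge
  exactly when the vertex is an endpoint of it.\<close>

lemma vertex_degree_one_edge_connection:
  fixes E1 :: "'a::finite set set" and E2 :: "'b::finite set set"
  shows "vertex_degree (one_edge_connection E1 u E2 v) (Inl a) =
      vertex_degree E1 a + (if a = u then 1 else 0)"
    and "vertex_degree (one_edge_connection E1 u E2 v) (Inr b) =
      vertex_degree E2 b + (if b = v then 1 else 0)"
proof -
  have "{e \<in> one_edge_connection E1 u E2 v. Inl a \<in> e} =
      (`) Inl ` {e \<in> E1. a \<in> e} \<union> (if a = u then {{Inl u, Inr v}} else {})"
    by (auto simp: one_edge_connection_def)
  \<comment> \<open>The bridge meets both sides, so it is not the image of an edge of one side, and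
    the cardinalities add.\<close>
  moreover have "{Inl u, Inr v} \<notin> (`) Inl ` S" for S
    by auto
  moreover have "card ((`) (Inl :: 'a \<Rightarrow> 'a + 'b) ` {e \<in> E1. a \<in> e}) = vertex_degree E1 a"
    unfolding vertex_degree_def by (intro card_image inj_on_image) auto
  ultimately show "vertex_degree (one_edge_connection E1 u E2 v) (Inl a) =
      vertex_degree E1 a + (if a = u then 1 else 0)"
    by (cases "a = u") (simp_all add: vertex_degree_def)
next
  have "{e \<in> one_edge_connection E1 u E2 v. Inr b \<in> e} =
      (`) Inr ` {e \<in> E2. b \<in> e} \<union> (if b = v then {{Inl u, Inr v}} else {})"
    by (auto simp: one_edge_connection_def)
  moreover have "{Inl u, Inr v} \<notin> (`) Inr ` S" for S
    by auto
  moreover have "card ((`) (Inr :: 'b \<Rightarrow> 'a + 'b) ` {e \<in> E2. b \<in> e}) = vertex_degree E2 b"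
    unfolding vertex_degree_def by (intro card_image inj_on_image) auto
  ultimately show "vertex_degree (one_edge_connection E1 u E2 v) (Inr b) =
      vertex_degree E2 b + (if b = v then 1 else 0)"
    by (cases "b = v") (simp_all add: vertex_degree_def)
qed

lemma sum_UNIV_sum_type:
  "(\<Sum>w\<in>(UNIV :: ('a::finite + 'b::finite) set). f w) =
    (\<Sum>a\<in>UNIV. f (Inl a)) + (\<Sum>b\<in>UNIV. f (Inr b))"
  by (simp add: sum.Plus flip: UNIV_Plus_UNIV)

text \<open>At an endpoint the bridge raises the degree by one and adds one neighbour; together
  these contribute the difference of the two end values.\<close>

lemma laplacian_one_edge_connection_mult_vec:
  fixes z :: "real^('a::finite + 'b::finite)"
  shows "(laplacian (one_edge_connection E1 u E2 v) *v z) $ Inl a =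
      (laplacian E1 *v (\<chi> i. z $ Inl i)) $ a + (if a = u then z $ Inl u - z $ Inr v else 0)"
    and "(laplacian (one_edge_connection E1 u E2 v) *v z) $ Inr b =
      (laplacian E2 *v (\<chi> i. z $ Inr i)) $ b + (if b = v then z $ Inr v - z $ Inl u else 0)"
  by (simp_all add: laplacian_mult_vec_nth sum_UNIV_sum_type adjacent_one_edge_connection
      vertex_degree_one_edge_connection algebra_simps cong: if_cong)

text \<open>Reading the equation side by side gives two blocks, coupled only through opposite
  multiples of the unit vectors at \<open>u\<close> and \<open>v\<close>.\<close>

lemma one_edge_connection_eigen_equation:
  fixes z :: "real^('a::finite + 'b::finite)"
  shows "laplacian (one_edge_connection E1 u E2 v) *v z = c *s z \<longleftrightarrow>
    laplacian E1 *v (\<chi> i. z $ Inl i) + (z $ Inl u - z $ Inr v) *s axis u 1 =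
      c *s (\<chi> i. z $ Inl i) \<and>
    laplacian E2 *v (\<chi> i. z $ Inr i) + (z $ Inr v - z $ Inl u) *s axis v 1 =
      c *s (\<chi> i. z $ Inr i)"
  by (auto simp: vec_eq_iff split_sum_all laplacian_one_edge_connection_mult_vec axis_def)

text \<open>This is the easy half of the Fredholm alternative: \<open>w\<close> lies in the range of
  the symmetric matrix \<open>c\<close> minus the Laplacian, hence is orthogonal to its kernel,
  which contains \<open>Z\<close>.\<close>

lemma inner_eigenvector_eq_0:
  assumes Z: "laplacian E *v Z = c *s Z" and X: "laplacian E *v X + w = c *s X"
  shows "Z \<bullet> w = 0"
proof -
  have "w = c *s X - laplacian E *v X"
    using X by (simp add: algebra_simps)
  then have "Z \<bullet> w = c * (Z \<bullet> X) - (laplacian E *v Z) \<bullet> X"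
    by (simp add: inner_diff_right inner_laplacian_commute scalar_mult_eq_scaleR)
  then show ?thesis
    by (simp add: Z scalar_mult_eq_scaleR)
qed

theorem theorem6:
  fixes G1 :: "'a::finite set set" and G2 :: "'b::finite set set"
    and u :: 'a and v :: 'b
  assumes "unicyclic G1" and "unicyclic G2"
    and "\<exists>M. perfect_matching G1 M"
    and "eigenvalue (laplacian G1) 2"
    and "\<not> eigenvalue (laplacian G2) 2"
  shows "eigenvalue (laplacian (one_edge_connection G1 u G2 v)) 2 \<longleftrightarrow>
    (\<exists>X. eigenvector (laplacian G1) 2 X \<and> X $ u = 0)"
proof
  assume "eigenvalue (laplacian (one_edge_connection G1 u G2 v)) 2"
  then obtain z where "z \<noteq> 0"
    and z: "laplacian (one_edge_connection G1 u G2 v) *v z = 2 *s z"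
    by (auto simp: eigenvalue_def eigenvector_def)
  define X where "X = (\<chi> i. z $ Inl i)"
  define Y where "Y = (\<chi> i. z $ Inr i)"
  have X: "laplacian G1 *v X + (X $ u - Y $ v) *s axis u 1 = 2 *s X"
    and Y: "laplacian G2 *v Y + (Y $ v - X $ u) *s axis v 1 = 2 *s Y"
    using z by (simp_all add: one_edge_connection_eigen_equation X_def Y_def)
  show "\<exists>X. eigenvector (laplacian G1) 2 X \<and> X $ u = 0"
  proof (cases "X $ u = Y $ v")
    case True
    then have "Y = 0"
      using Y assms(5) by (auto simp: eigenvalue_def eigenvector_def)
    moreover have "X \<noteq> 0"
      using \<open>z \<noteq> 0\<close> \<open>Y = 0\<close> by (auto simp: X_def Y_def vec_eq_iff split_sum_all)
    ultimately show ?thesis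
      using True X by (auto simp: eigenvector_def)
  next
    case False
    \<comment> \<open>Here \<open>X\<close> solves only an inhomogeneous equation, so the witness
      has to be another vector; any eigenvector of \<open>G1\<close> for 2 will do.\<close>
    obtain Z where Z: "eigenvector (laplacian G1) 2 Z"
      using assms(4) by (auto simp: eigenvalue_def)
    then have "Z \<bullet> ((X $ u - Y $ v) *s axis u 1) = 0"
      using X by (auto simp: eigenvector_def intro: inner_eigenvector_eq_0)
    with False have "Z $ u = 0"
      by (simp add: scalar_mult_eq_scaleR inner_axis)
    with Z show ?thesis
      by blast
  qed
next
  assume "\<exists>X. eigenvector (laplacian G1) 2 X \<and> X $ u = 0"
  then obtain X where X: "X \<noteq> 0" "laplacian G1 *v X = 2 *s X" "X $ u = 0"
    by (auto simp: eigenvector_def)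
  define z :: "real^('a + 'b)" where "z = (\<chi> i. case i of Inl a \<Rightarrow> X $ a | Inr b \<Rightarrow> 0)"
  have "z \<noteq> 0"
    using X(1) by (auto simp: z_def vec_eq_iff split_sum_all)
  moreover have "(\<chi> i. z $ Inl i) = X" "(\<chi> i. z $ Inr i) = 0"
    by (simp_all add: z_def vec_eq_iff)
  \<comment> \<open>Both coupling terms vanish, since \<open>z\<close> is 0 at both ends of the
    bridge.\<close>
  then have "laplacian (one_edge_connection G1 u G2 v) *v z = 2 *s z"
    using X by (simp add: one_edge_connection_eigen_equation z_def)
  ultimately show "eigenvalue (laplacian (one_edge_connection G1 u G2 v)) 2"
    by (auto simp: eigenvalue_def eigenvector_def)
qed

end
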